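(* Let $\mathbb{J}$ be a real symmetric $N\times N$ matrix with vanishing diagonal, and for $\boldsymbol\kappa\in\mathbb{R}^N$ put $\mathbb{J}(\boldsymbol\kappa)=\mathbb{J}+\operatorname{diag}(\kappa_1,\ldots,\kappa_N)$. (i) If $\mathbf{s}$ is a ground state of $\mathbb{J}$ and $\check{\boldsymbol\kappa}\in\mathbb{R}^N$ satisfies $\mathbb{J}(\check{\boldsymbol\kappa})\mathbf{s}=0$ (i.e. $\check{\boldsymbol\kappa}$ are Lagrange parameters of $\mathbf{s}$), then $\mathbb{J}(\check{\boldsymbol\kappa})\,G(\mathbf{s})=0$. (ii) Let $S\subseteq\mathbb{R}^N$ be a completely elliptic subspace such that $\mathcal{F}_S=\{G\in\mathcal{G}_N:\operatorname{range}G\subseteq S\}$ is a non-trivial closed face of $\mathcal{G}_N$, and let $S^\perp$ be the orthogonal complement of $S$. Then every positive semi-definite real symmetric $N\times N$ matrix $A$ with support (range) $S^\perp$ can be written as $A=\mathbb{J}'(\boldsymbol\kappa)$, where $\mathbb{J}'$ is the zero-diagonal matrix equal to $A$ off the diagonal and $\kappa_\mu=A_{\mu\mu}$, such that for every configuration $\mathbf{s}$ with $G(\mathbf{s})\in\mathcal{F}_S$, $\mathbf{s}$ is a ground state of $\mathbb{J}'$ with Lagrange parameters $\boldsymbol\kappa$, i.e. $\mathbb{J}'(\boldsymbol\kappa)\mathbf{s}=0$. (iii) Let $G_0$ be a boundary point of $\mathcal{G}_N$ (i.e. $\operatorname{rank}G_0<N$) and let $\mathcal{F}_0$ be the closed face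 of $\mathcal{G}_N$ generated by $G_0$. Then $\mathcal{F}_0=\{G\in\mathcal{G}_N:\operatorname{range}G\subseteq S\}$ for some completely elliptic subspace $S\subseteq\mathbb{R}^N$. Moreover, let $\mathcal{C}(G_0)$ be the convex cone of all linear functionals $\ell$ on the space $\mathcal{L}_N$ of real symmetric $N\times N$ matrices with vanishing diagonal such that $\ell(G-G_0)\ge0$ for all $G\in\mathcal{G}_N$. Then $A\mapsto f(A)$, $f(A)(X)=\operatorname{Tr}(AX)$ for $X\in\mathcal{L}_N$, is an affine bijection from the cone of positive semi-definite real symmetric $N\times N$ matrices $A$ with range contained in $S^\perp$ onto $\mathcal{C}(G_0)$.
   Context: $\mathcal{G}_N$ is the set of real symmetric positive semi-definite $N\times N$ matrices with all diagonal entries equal to $1$. For $M\ge1$, a spin configuration is a real $N\times M$ matrix $\mathbf{s}$ whose rows $\mathbf{s}_\mu$ are unit vectors of $\mathbb{R}^M$; its Gram matrix is $G(\mathbf{s})=\mathbf{s}\mathbf{s}^\top\in\mathcal{G}_N$. The Heisenberg energy is $H(\mathbf{s})=\sum_{\mu,\nu=1}^N J_{\mu\nu}\,\mathbf{s}_\mu\cdot\mathbf{s}_\nu=\operatorname{Tr}(\mathbb{J}G(\mathbf{s}))$. A ground state of $\mathbb{J}$ is a configuration $\mathbf{s}$ at which $H$ attains its global minimum (equivalently, $G(\mathbf{s})$ minimizes $G\mapsto\operatorname{Tr}(\mathbb{J}G)$ over $\mathcal{G}_N$). A subspace $S\subseteq\mathbb{R}^N$ of dimension $M$ is completely elliptic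 if there is an $N\times M$ matrix whose columns lie in $S$, whose rows are unit vectors and whose rank is $M$. A face of a convex set $C$ is a convex subset $F\subseteq C$ such that $x=\alpha y+(1-\alpha)z$ with $x\in F$, $y,z\in C$, $0<\alpha<1$ implies $y,z\in F$; the face generated by a point is the smallest face containing it; a face is non-trivial if it differs from $\emptyset$ and $\mathcal{G}_N$. *)

theory Defs
  imports "HOL-Analysis.Analysis"
begin

(* real symmetric N x N matrices; N = CARD('n) *)
definition sym_mat :: "real^'n^'n \<Rightarrow> bool" where
  "sym_mat A \<longleftrightarrow> transpose A = A"

definition psd :: "real^'n^'n \<Rightarrow> bool" where
  "psd A \<longleftrightarrow> sym_mat A \<and> (\<forall>x. 0 \<le> x \<bullet> (A *v x))"

(* the set G_N *)
definition GN :: "(real^'n^'n) set" where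
  "GN = {G. psd G \<and> (\<forall>i. G $ i $ i = 1)}"

(* spin configuration: N x M matrix with unit rows, M = CARD('m) *)
definition spin_config :: "real^'m^'n \<Rightarrow> bool" where
  "spin_config s \<longleftrightarrow> (\<forall>\<mu>. norm (s $ \<mu>) = 1)"

definition Gram :: "real^'m^'n \<Rightarrow> real^'n^'n" where
  "Gram s = s ** transpose s"

definition heis_energy :: "real^'n^'n \<Rightarrow> real^'m^'n \<Rightarrow> real" where
  "heis_energy J s = (\<Sum>\<mu>\<in>UNIV. \<Sum>\<nu>\<in>UNIV. J $ \<mu> $ \<nu> * (s $ \<mu> \<bullet> s $ \<nu>))"

(* ground state: G(s) minimizes G \<mapsto> Tr(J G) over G_N *)
definition ground_state :: "real^'n^'n \<Rightarrow> real^'m^'n \<Rightarrow> bool" where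
  "ground_state J s \<longleftrightarrow> spin_config s \<and>
     (\<forall>G\<in>GN. trace (J ** Gram s) \<le> trace (J ** G))"

definition diagm :: "real^'n \<Rightarrow> real^'n^'n" where
  "diagm k = (\<chi> i j. if i = j then k $ i else 0)"

(* J(kappa) = J + diag(kappa) *)
definition Jk :: "real^'n^'n \<Rightarrow> real^'n \<Rightarrow> real^'n^'n" where
  "Jk J k = J + diagm k"

definition zero_diag :: "real^'n^'n \<Rightarrow> bool" where
  "zero_diag J \<longleftrightarrow> (\<forall>i. J $ i $ i = 0)"

(* completely elliptic subspace of dimension M = dim S: there is an N x M matrix
   (columns v 0, ..., v (M-1)) with columns in S, unit rows and rank M *)
definition completely_elliptic :: "(real^'n) set \<Rightarrow> bool" where
  "completely_elliptic S \<longleftrightarrow> subspace S \<and>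
     (\<exists>v :: nat \<Rightarrow> real^'n.
        (\<forall>j<dim S. v j \<in> S) \<and>
        (\<forall>\<mu>. (\<Sum>j<dim S. (v j $ \<mu>)\<^sup>2) = 1) \<and>
        dim (span (v ` {..<dim S})) = dim S)"

(* F_S = {G in G_N. range G \<subseteq> S} *)
definition face_of_subspace :: "(real^'n) set \<Rightarrow> (real^'n^'n) set" where
  "face_of_subspace S = {G \<in> GN. range ((*v) G) \<subseteq> S}"

(* face generated by a point: smallest face containing it *)
definition face_generated :: "(real^'n^'n) set \<Rightarrow> real^'n^'n \<Rightarrow> (real^'n^'n) set" where
  "face_generated C x = \<Inter>{F. F face_of C \<and> x \<in> F}"

(* L_N: real symmetric matrices with vanishing diagonal *)
definition LN :: "(real^'n^'n) set" where
  "LN = {X. sym_mat X \<and> zero_diag X}"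

(* linear functionals on L_N, represented as functions vanishing outside L_N *)
definition lin_functionals :: "(real^'n^'n \<Rightarrow> real) set" where
  "lin_functionals = {l. (\<forall>X\<in>LN. \<forall>Y\<in>LN. l (X + Y) = l X + l Y) \<and>
       (\<forall>c. \<forall>X\<in>LN. l (c *\<^sub>R X) = c * l X) \<and> (\<forall>X. X \<notin> LN \<longrightarrow> l X = 0)}"

(* the cone C(G0) *)
definition cone_C :: "real^'n^'n \<Rightarrow> (real^'n^'n \<Rightarrow> real) set" where
  "cone_C G0 = {l \<in> lin_functionals. \<forall>G\<in>GN. 0 \<le> l (G - G0)}"

(* f(A)(X) = Tr(A X) for X in L_N *)
definition tr_functional :: "real^'n^'n \<Rightarrow> (real^'n^'n \<Rightarrow> real)" where
  "tr_functional A = (\<lambda>X. if X \<in> LN then trace (A ** X) else 0)"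

end

theory Submission
  imports Defs
begin

text \<open>Everything rests on the trace pairing of positive semi-definite matrices: \<open>tr (A G) \<ge> 0\<close>,
  with equality only if \<open>A G = 0\<close>, as one sees by writing \<open>G\<close> as a sum of rank-one matrices
  \<open>v v\<^sup>T\<close>. Part (i) is associativity of the matrix product. In (ii), \<open>A\<close> annihilates
  \<open>S \<supseteq> range G(s)\<close>, hence \<open>A s = 0\<close>, and on \<open>GN\<close> one has
  \<open>tr (J' G) = tr (A G) - \<Sum>\<kappa> \<ge> - \<Sum>\<kappa> = tr (J' G(s))\<close>.
  In (iii) take \<open>S = range G\<^sub>0\<close>. Then \<open>F\<^sub>S\<close> is a face, and every face through \<open>G\<^sub>0\<close>
  contains \<open>F\<^sub>S\<close> because \<open>G\<^sub>0\<close> lies in its relative interior; a rank-one factorisation of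
  \<open>G\<^sub>0\<close> exhibits \<open>S\<close> as completely elliptic. The map \<open>A \<mapsto> tr (A \<cdot>)\<close> is injective on
  \<open>{A \<succeq> 0. A G\<^sub>0 = 0}\<close> because \<open>G\<^sub>0\<close> has unit diagonal, and it is onto \<open>C(G\<^sub>0)\<close> by
  Lagrange duality: a functional in \<open>C(G\<^sub>0)\<close> is \<open>tr (J \<cdot>)\<close> on \<open>LN\<close> for some \<open>J\<close> such that
  \<open>G\<^sub>0\<close> minimises \<open>tr (J G)\<close> over \<open>GN\<close>; a multiplier \<open>\<kappa>\<close> makes \<open>G\<^sub>0\<close> minimise
  \<open>tr (J(\<kappa>) G)\<close> over the whole cone \<open>G \<succeq> 0\<close>, which forces \<open>J(\<kappa>) \<succeq> 0\<close> and
  \<open>J(\<kappa>) G\<^sub>0 = 0\<close>.\<close>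

section \<open>Positive semi-definite matrices\<close>

lemma sym_mat_entry: "sym_mat G \<Longrightarrow> G $ i $ j = G $ j $ i"
  unfolding sym_mat_def by (metis transpose_def vec_lambda_beta)

lemma sym_mat_inner_mv:
  fixes G :: "real^'n^'n"
  assumes "sym_mat G"
  shows "x \<bullet> (G *v y) = (G *v x) \<bullet> y"
proof -
  have "x \<bullet> (G *v y) = (\<Sum>i\<in>UNIV. \<Sum>j\<in>UNIV. x $ i * G $ i $ j * y $ j)"
    by (simp add: inner_vec_def matrix_vector_mult_def sum_distrib_left mult.assoc)
  also have "\<dots> = (\<Sum>j\<in>UNIV. \<Sum>i\<in>UNIV. x $ i * G $ i $ j * y $ j)"
    by (rule sum.swap)
  also have "\<dots> = (\<Sum>j\<in>UNIV. y $ j * (\<Sum>i\<in>UNIV. G $ j $ i * x $ i))"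
    by (simp add: sum_distrib_left sym_mat_entry[OF assms] mult_ac)
  also have "\<dots> = (G *v x) \<bullet> y"
    by (simp add: inner_vec_def matrix_vector_mult_def mult.commute)
  finally show ?thesis .
qed

lemma psd_sym: "psd G \<Longrightarrow> sym_mat G"
  by (simp add: psd_def)

lemma psd_nonneg: "psd G \<Longrightarrow> 0 \<le> x \<bullet> (G *v x)"
  by (simp add: psd_def)

lemma psd_inner_mv_square_le:
  fixes G :: "real^'n^'n"
  assumes "psd G"
  shows "(x \<bullet> (G *v y))\<^sup>2 \<le> (x \<bullet> (G *v x)) * (y \<bullet> (G *v y))"
proof -
  define a b c where "a = x \<bullet> (G *v x)" and "b = x \<bullet> (G *v y)" and "c = y \<bullet> (G *v y)"
  have yx: "y \<bullet> (G *v x) = b"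
    unfolding b_def by (metis sym_mat_inner_mv[OF psd_sym[OF assms]] inner_commute)
  have q: "0 \<le> a + 2 * t * b + t\<^sup>2 * c" for t
  proof -
    have "0 \<le> (x + t *\<^sub>R y) \<bullet> (G *v (x + t *\<^sub>R y))"
      using psd_nonneg[OF assms] .
    also have "\<dots> = a + 2 * t * b + t\<^sup>2 * c"
      by (simp add: matrix_vector_right_distrib vec.scale inner_add_left inner_add_right
          a_def b_def c_def yx power2_eq_square algebra_simps)
    finally show ?thesis .
  qed
  show ?thesis
  proof (cases "c = 0")
    case True
    \<comment> \<open>a quadratic form vanishing at \<open>y\<close> makes \<open>q\<close> affine in \<open>t\<close>, so \<open>b = 0\<close>\<close>
    have "b = 0"
    proof (rule ccontr)
      assume "b \<noteq> 0"
      have "0 \<le> a + 2 * (-(a+1)/(2*b)) * b + (-(a+1)/(2*b))\<^sup>2 * c" by (rule q)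
      also have "\<dots> = -1" using \<open>b \<noteq> 0\<close> True by (simp add: field_simps)
      finally show False by simp
    qed
    then show ?thesis using True by (simp flip: b_def c_def)
  next
    case False
    then have cp: "c > 0" using psd_nonneg[OF assms, of y] by (simp add: c_def)
    have "0 \<le> a + 2 * (-b/c) * b + (-b/c)\<^sup>2 * c" by (rule q)
    also have "\<dots> = a - b\<^sup>2 / c" using cp by (simp add: field_simps power2_eq_square)
    finally show ?thesis using cp by (simp add: a_def b_def c_def field_simps)
  qed
qed

lemma psd_quadratic_form_eq_0D:
  fixes G :: "real^'n^'n"
  assumes "psd G" "x \<bullet> (G *v x) = 0"
  shows "G *v x = 0"
proof -
  have "(x \<bullet> (G *v (G *v x)))\<^sup>2 \<le> 0"
    using psd_inner_mv_square_le[OF assms(1), of x "G *v x"] assms(2) by simp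
  then have "x \<bullet> (G *v (G *v x)) = 0" by simp
  then have "(G *v x) \<bullet> (G *v x) = 0"
    using sym_mat_inner_mv[OF psd_sym[OF assms(1)]] by metis
  then show ?thesis by simp
qed

lemma mv_scaleR_combination:
  "(u *\<^sub>R (A::real^'n^'m) + v *\<^sub>R B) *v x = u *\<^sub>R (A *v x) + v *\<^sub>R (B *v x)"
  by (simp add: matrix_vector_mult_add_rdistrib scaleR_matrix_vector_assoc)

lemma psd_combination:
  fixes A B :: "real^'n^'n"
  assumes "psd A" "psd B" "0 \<le> u" "0 \<le> v"
  shows "psd (u *\<^sub>R A + v *\<^sub>R B)"
  unfolding psd_def
proof (intro conjI allI)
  show "sym_mat (u *\<^sub>R A + v *\<^sub>R B)"
    using sym_mat_entry[OF psd_sym[OF assms(1)]] sym_mat_entry[OF psd_sym[OF assms(2)]]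
    by (simp add: sym_mat_def vec_eq_iff transpose_def)
  fix x
  have "0 \<le> u * (x \<bullet> (A *v x)) + v * (x \<bullet> (B *v x))"
    using assms psd_nonneg by (intro add_nonneg_nonneg mult_nonneg_nonneg) auto
  then show "0 \<le> x \<bullet> ((u *\<^sub>R A + v *\<^sub>R B) *v x)"
    by (simp add: mv_scaleR_combination inner_add_right)
qed

lemma psd_scaleR: "psd A \<Longrightarrow> 0 \<le> r \<Longrightarrow> psd (r *\<^sub>R (A::real^'n^'n))"
  using psd_combination[of A A r 0] by simp

lemma psd_0: "psd (0::real^'n^'n)"
  by (simp add: psd_def sym_mat_def transpose_def vec_eq_iff)

lemma convex_psd: "convex {A::real^'n^'n. psd A}"
  unfolding convex_def by (auto intro: psd_combination)

lemma diagm_mv: "diagm d *v x = (\<chi> i. d $ i * x $ i)"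
  by (simp add: vec_eq_iff matrix_vector_mult_def diagm_def if_distrib if_distribR cong: if_cong)

lemma psd_diagm:
  assumes "\<And>i. 0 \<le> d $ i"
  shows "psd (diagm d)"
  unfolding psd_def
proof (intro conjI allI)
  show "sym_mat (diagm d)" by (auto simp: sym_mat_def transpose_def vec_eq_iff diagm_def)
  fix x
  have "x \<bullet> (diagm d *v x) = (\<Sum>i\<in>UNIV. d $ i * (x $ i * x $ i))"
    by (simp add: diagm_mv inner_vec_def mult_ac)
  also have "\<dots> \<ge> 0" using assms by (intro sum_nonneg) simp
  finally show "0 \<le> x \<bullet> (diagm d *v x)" .
qed

definition outer :: "real^'n \<Rightarrow> real^'n^'n" where
  "outer v = (\<chi> i j. v $ i * v $ j)"

lemma outer_mv: "outer v *v y = (v \<bullet> y) *\<^sub>R v"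
  by (simp add: vec_eq_iff outer_def matrix_vector_mult_def inner_vec_def sum_distrib_left mult_ac)

lemma sum_outer_mv: "(\<Sum>j<(K::nat). outer (v j)) *v x = (\<Sum>j<K. (v j \<bullet> x) *\<^sub>R v j)"
proof -
  have "(\<Sum>j\<in>J. outer (v j)) *v x = (\<Sum>j\<in>J. outer (v j) *v x)" if "finite J" for J :: "nat set"
    using that by (induction J rule: finite_induct) (simp_all add: matrix_vector_mult_add_rdistrib)
  then show ?thesis by (simp add: outer_mv)
qed

lemma psd_outer: "psd (outer x)"
  unfolding psd_def
proof (intro conjI allI)
  show "sym_mat (outer x)" by (simp add: sym_mat_def transpose_def vec_eq_iff outer_def mult.commute)
  fix y
  show "0 \<le> y \<bullet> (outer x *v y)" by (simp add: outer_mv inner_commute)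
qed

lemma subspace_range_mv: "subspace (range ((*v) (G::real^'n^'m)))"
  by (rule linear_subspace_image[OF matrix_vector_mul_linear subspace_UNIV])

lemma psd_minus_outer:
  fixes G :: "real^'n^'n"
  assumes psdG: "psd G" and qp: "0 < x \<bullet> (G *v x)"
  defines "v \<equiv> (1 / sqrt (x \<bullet> (G *v x))) *\<^sub>R (G *v x)"
  shows "v \<in> range ((*v) G)" "psd (G - outer v)"
    "dim (range ((*v) (G - outer v))) < dim (range ((*v) G))"
proof -
  define q where "q = x \<bullet> (G *v x)"
  define G1 where "G1 = G - outer v"
  define R where "R = range ((*v) G)"
  have "v = G *v ((1 / sqrt q) *\<^sub>R x)"
    by (simp add: v_def q_def matrix_vector_mult_scaleR)
  then show vR: "v \<in> range ((*v) G)" by auto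
  have G1y: "G1 *v y = G *v y - (v \<bullet> y) *\<^sub>R v" for y
    by (simp add: G1_def matrix_vector_mult_diff_rdistrib outer_mv)
  have vy: "v \<bullet> y = (1 / sqrt q) * (x \<bullet> (G *v y))" for y
    unfolding v_def q_def using sym_mat_inner_mv[OF psd_sym[OF psdG], of x y] by simp
  have sym1: "sym_mat G1"
    using sym_mat_entry[OF psd_sym[OF psdG]]
    by (simp add: sym_mat_def G1_def vec_eq_iff transpose_def outer_def mult.commute)
  show "psd (G - outer v)"
    unfolding psd_def G1_def[symmetric]
  proof (intro conjI sym1 allI)
    fix y
    have "(x \<bullet> (G *v y))\<^sup>2 \<le> q * (y \<bullet> (G *v y))"
      using psd_inner_mv_square_le[OF psdG, of x y] by (simp add: q_def)
    then have "(v \<bullet> y)\<^sup>2 \<le> y \<bullet> (G *v y)"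
      using qp by (simp add: vy q_def power_mult_distrib power_divide field_simps)
    then show "0 \<le> y \<bullet> (G1 *v y)"
      by (simp add: G1y inner_diff_right power2_eq_square inner_commute)
  qed
  have sub: "range ((*v) G1) \<subseteq> R"
    using subspace_range_mv[of G] vR
    by (auto simp: G1y R_def intro!: subspace_diff subspace_scale)
  have "v \<bullet> x = sqrt q"
    using qp by (simp add: vy q_def inner_commute real_div_sqrt)
  then have G1x: "G1 *v x = 0"
    using qp by (simp add: G1y v_def q_def)
  have "G *v x \<notin> range ((*v) G1)"
  proof
    assume "G *v x \<in> range ((*v) G1)"
    then obtain y where "G *v x = G1 *v y" by auto
    then have "q = (G1 *v x) \<bullet> y"
      by (simp add: q_def sym_mat_inner_mv[OF sym1])
    then show False using G1x qp q_def by simp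
  qed
  then have "range ((*v) G1) \<subset> R"
    using sub by (auto simp: R_def)
  then show "dim (range ((*v) (G - outer v))) < dim (range ((*v) G))"
    using subspace_range_mv[of G1] subspace_range_mv[of G]
    by (metis G1_def R_def dim_psubset span_eq_iff)
qed

lemma psd_eq_sum_outer:
  fixes G :: "real^'n^'n"
  assumes "psd G"
  shows "\<exists>K v. K \<le> dim (range ((*v) G)) \<and> (\<forall>j<K. v j \<in> range ((*v) G)) \<and>
            G = (\<Sum>j<K. outer (v j))"
  using assms
proof (induction "dim (range ((*v) G))" arbitrary: G rule: less_induct)
  case less
  show ?case
  proof (cases "\<forall>x. x \<bullet> (G *v x) = 0")
    case True
    then have "G = 0" using psd_quadratic_form_eq_0D[OF less.prems] by (simp add: matrix_eq)
    then show ?thesis by (intro exI[of _ 0]) auto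
  next
    case False
    then obtain x where "0 < x \<bullet> (G *v x)"
      using psd_nonneg[OF less.prems] by (metis order_le_less)
    note peel = psd_minus_outer[OF less.prems this]
    define v where "v = (1 / sqrt (x \<bullet> (G *v x))) *\<^sub>R (G *v x)"
    have sub: "range ((*v) (G - outer v)) \<subseteq> range ((*v) G)"
      using subspace_range_mv[of G] peel(1)
      by (auto simp: v_def matrix_vector_mult_diff_rdistrib outer_mv intro!: subspace_diff subspace_scale)
    obtain K w where K: "K \<le> dim (range ((*v) (G - outer v)))"
      "\<forall>j<K. w j \<in> range ((*v) (G - outer v))" "G - outer v = (\<Sum>j<K. outer (w j))"
      using less.hyps[OF peel(3) peel(2)] unfolding v_def by blast
    show ?thesis
    proof (intro exI conjI)
      show "Suc K \<le> dim (range ((*v) G))" using K(1) peel(3) unfolding v_def by simp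
      show "\<forall>j<Suc K. (w(K := v)) j \<in> range ((*v) G)"
        using K(2) sub peel(1) unfolding v_def by (auto simp: less_Suc_eq)
      have "G = (G - outer v) + outer v" by simp
      then show "G = (\<Sum>j<Suc K. outer ((w(K := v)) j))" by (simp add: K(3))
    qed
  qed
qed

section \<open>The trace pairing\<close>

lemma trace_mult_eq_sum:
  "trace ((A::real^'n^'n) ** G) = (\<Sum>i\<in>UNIV. \<Sum>k\<in>UNIV. A $ i $ k * G $ k $ i)"
  by (simp add: trace_def matrix_matrix_mult_def)

lemma trace_mult_outer: "trace ((A::real^'n^'n) ** outer v) = v \<bullet> (A *v v)"
  by (simp add: trace_mult_eq_sum outer_def inner_vec_def matrix_vector_mult_def
      sum_distrib_left mult_ac)

lemma trace_mult_add_left: "trace (((A::real^'n^'n) + B) ** G) = trace (A ** G) + trace (B ** G)"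
  by (simp add: trace_mult_eq_sum sum.distrib distrib_right)

lemma trace_mult_add_right: "trace ((A::real^'n^'n) ** (X + Y)) = trace (A ** X) + trace (A ** Y)"
  by (simp add: matrix_add_ldistrib trace_add)

lemma trace_mult_diff_right: "trace ((A::real^'n^'n) ** (X - Y)) = trace (A ** X) - trace (A ** Y)"
  by (simp add: trace_mult_eq_sum sum_subtractf right_diff_distrib)

lemma trace_mult_scaleR_right: "trace ((A::real^'n^'n) ** (c *\<^sub>R X)) = c * trace (A ** X)"
  by (simp add: trace_mult_eq_sum sum_distrib_left mult_ac)

lemma trace_mult_scaleR_combination_left:
  "trace ((u *\<^sub>R (A::real^'n^'n) + v *\<^sub>R B) ** X) = u * trace (A ** X) + v * trace (B ** X)"
  by (simp add: trace_mult_eq_sum sum.distrib sum_distrib_left distrib_right mult.assoc)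

lemma trace_mult_sum_right:
  "trace ((A::real^'n^'n) ** (\<Sum>j<(K::nat). M j)) = (\<Sum>j<K. trace (A ** M j))"
proof (induction K)
  case 0
  then show ?case by (simp add: trace_def)
qed (simp add: trace_mult_add_right)

lemma trace_diagm_mult: "trace (diagm k ** (G::real^'n^'n)) = (\<Sum>i\<in>UNIV. k $ i * G $ i $ i)"
  by (simp add: trace_mult_eq_sum diagm_def if_distrib if_distribR cong: if_cong)

lemma trace_Jk_mult: "trace (Jk J k ** G) = trace (J ** G) + k \<bullet> (\<chi> i. G $ i $ i)"
  by (simp add: Jk_def trace_mult_add_left trace_diagm_mult inner_vec_def)

lemma trace_mult_psd_nonneg:
  fixes A G :: "real^'n^'n"
  assumes "psd A" "psd G"
  shows "0 \<le> trace (A ** G)"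
proof -
  obtain K :: nat and v where "G = (\<Sum>j<K. outer (v j))"
    using psd_eq_sum_outer[OF assms(2)] by blast
  then have "trace (A ** G) = (\<Sum>j<K. v j \<bullet> (A *v v j))"
    by (simp add: trace_mult_sum_right trace_mult_outer)
  also have "\<dots> \<ge> 0" using psd_nonneg[OF assms(1)] by (simp add: sum_nonneg)
  finally show ?thesis .
qed

lemma trace_mult_psd_eq_0D:
  fixes A G :: "real^'n^'n"
  assumes "psd A" "psd G" "trace (A ** G) = 0"
  shows "A ** G = 0"
proof -
  obtain K :: nat and v where G: "G = (\<Sum>j<K. outer (v j))"
    using psd_eq_sum_outer[OF assms(2)] by blast
  then have "(\<Sum>j<K. v j \<bullet> (A *v v j)) = 0"
    using assms(3) by (simp add: trace_mult_sum_right trace_mult_outer)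
  then have "\<forall>j\<in>{..<K}. v j \<bullet> (A *v v j) = 0"
    using psd_nonneg[OF assms(1)] by (simp add: sum_nonneg_eq_0_iff)
  then have "\<And>j. j < K \<Longrightarrow> A *v v j = 0"
    using psd_quadratic_form_eq_0D[OF assms(1)] by blast
  then have "(A ** G) *v x = 0" for x
    by (simp add: G flip: matrix_vector_mul_assoc)
      (simp add: sum_outer_mv matrix_vector_mult_scaleR vec.sum)
  then show ?thesis by (simp add: matrix_eq)
qed

lemma sym_mat_mv_eq_0_if_range_orthogonal:
  fixes A :: "real^'n^'n"
  assumes "sym_mat A" "range ((*v) A) \<subseteq> orthogonal_comp S" "y \<in> S"
  shows "A *v y = 0"
proof -
  have "y \<bullet> (A *v (A *v y)) = 0"
    using assms(2,3) by (auto simp: orthogonal_comp_def orthogonal_def)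
  then have "(A *v y) \<bullet> (A *v y) = 0" using sym_mat_inner_mv[OF assms(1)] by metis
  then show ?thesis by simp
qed

lemma sym_mat_mult_eq_0_if_range_orthogonal:
  fixes A G :: "real^'n^'n"
  assumes "sym_mat A" "range ((*v) A) \<subseteq> orthogonal_comp S" "range ((*v) G) \<subseteq> S"
  shows "A ** G = 0"
  using sym_mat_mv_eq_0_if_range_orthogonal[OF assms(1,2)] assms(3)
  by (auto simp: matrix_eq simp flip: matrix_vector_mul_assoc)

lemma matrix_mult_transpose_self_eq_0D:
  fixes M :: "real^'m^'n"
  assumes "M ** transpose M = 0"
  shows "M = 0"
proof -
  have "(\<Sum>k\<in>UNIV. M $ i $ k * M $ i $ k) = 0" for i
    using assms by (simp add: vec_eq_iff matrix_matrix_mult_def transpose_def)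
  then have "M $ i $ k * M $ i $ k = 0" for i k
    by (subst (asm) sum_nonneg_eq_0_iff) auto
  then show ?thesis by (simp add: vec_eq_iff)
qed

lemma Jk_off_diagonal_diagonal:
  "A = Jk (\<chi> i j. if i = j then 0 else A $ i $ j) (\<chi> i. A $ i $ i)"
  by (simp add: vec_eq_iff Jk_def diagm_def)

lemma sym_mat_off_diagonal:
  assumes "sym_mat A"
  shows "sym_mat (\<chi> i j. if i = j then 0 else A $ i $ j)"
  using sym_mat_entry[OF assms] by (simp add: sym_mat_def vec_eq_iff transpose_def)

lemma ground_state_if_range_orthogonal:
  fixes A :: "real^'n^'n" and s :: "real^'m^'n"
  assumes psdA: "psd A" and rA: "range ((*v) A) \<subseteq> orthogonal_comp S"
    and s: "spin_config s" "Gram s \<in> face_of_subspace S"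
  defines "J' \<equiv> \<chi> i j. if i = j then 0 else A $ i $ j" and "k \<equiv> \<chi> i. A $ i $ i"
  shows "ground_state J' s" "Jk J' k ** s = 0"
proof -
  have AJ: "A = Jk J' k" unfolding J'_def k_def by (rule Jk_off_diagonal_diagonal)
  have gs: "Gram s \<in> GN" "range ((*v) (Gram s)) \<subseteq> S"
    using s(2) by (auto simp: face_of_subspace_def)
  have AG: "A ** Gram s = 0"
    by (rule sym_mat_mult_eq_0_if_range_orthogonal[OF psd_sym[OF psdA] rA gs(2)])
  have "(A ** s) ** transpose (A ** s) = (A ** Gram s) ** transpose A"
    by (simp add: Gram_def matrix_transpose_mul matrix_mul_assoc)
  then have "(A ** s) ** transpose (A ** s) = 0"
    using AG by simp
  then show "Jk J' k ** s = 0"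
    using AJ matrix_mult_transpose_self_eq_0D by metis
  have trG: "trace (J' ** G) = trace (A ** G) - k \<bullet> (\<chi> i. 1)" if "G \<in> GN" for G
    using that by (simp add: AJ trace_Jk_mult GN_def)
  show "ground_state J' s"
    unfolding ground_state_def
  proof (intro conjI ballI s(1))
    fix G :: "real^'n^'n" assume G: "G \<in> GN"
    have "0 \<le> trace (A ** G)" using G psdA by (intro trace_mult_psd_nonneg) (auto simp: GN_def)
    then show "trace (J' ** Gram s) \<le> trace (J' ** G)"
      using trG[OF G] trG[OF gs(1)] AG by (simp add: trace_def)
  qed
qed

section \<open>Faces of \<open>GN\<close>\<close>

lemma GN_combination:
  assumes "A \<in> GN" "B \<in> GN" "0 \<le> u" "0 \<le> v" "u + v = 1"
  shows "u *\<^sub>R (A::real^'n^'n) + v *\<^sub>R B \<in> GN"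
  using assms psd_combination[of A B u v] by (auto simp: GN_def)

text \<open>On \<open>S\<^sup>\<perp>\<close> the quadratic forms of \<open>a\<close> and \<open>b\<close> are nonnegative with a vanishing proper convex
  combination, so \<open>a\<close> annihilates \<open>S\<^sup>\<perp>\<close>.\<close>
lemma face_of_subspace_convex_combination_left:
  fixes a b :: "real^'n^'n"
  assumes S: "subspace S" and ab: "a \<in> GN" "b \<in> GN" and u: "0 < u" "u < 1"
    and x: "(1 - u) *\<^sub>R a + u *\<^sub>R b \<in> face_of_subspace S"
  shows "a \<in> face_of_subspace S"
proof -
  have psda: "psd a" and psdb: "psd b" using ab by (auto simp: GN_def)
  have ay: "a *v y = 0" if y: "y \<in> orthogonal_comp S" for y
  proof -
    have "(((1 - u) *\<^sub>R a + u *\<^sub>R b) *v y) \<bullet> y = 0"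
      using x y by (auto simp: face_of_subspace_def orthogonal_comp_def orthogonal_def)
    then have "(1 - u) * (y \<bullet> (a *v y)) + u * (y \<bullet> (b *v y)) = 0"
      by (simp add: mv_scaleR_combination inner_add_right inner_commute)
    moreover have "0 \<le> y \<bullet> (a *v y)" "0 \<le> y \<bullet> (b *v y)"
      using psda psdb psd_nonneg by auto
    ultimately have "y \<bullet> (a *v y) = 0"
      using u by (smt (verit) mult_nonneg_nonneg mult_pos_pos)
    then show ?thesis by (rule psd_quadratic_form_eq_0D[OF psda])
  qed
  have "a *v z \<in> orthogonal_comp (orthogonal_comp S)" for z
    using ay sym_mat_inner_mv[OF psd_sym[OF psda], of _ z]
    by (auto simp: orthogonal_comp_def orthogonal_def)
  then show ?thesis
    using ab(1) orthogonal_comp_self[OF S] by (auto simp: face_of_subspace_def)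
qed

lemma face_of_subspace_face_of_GN:
  assumes S: "subspace S"
  shows "face_of_subspace S face_of (GN :: (real^'n^'n) set)"
  unfolding face_of_def
proof (intro conjI ballI impI)
  show "face_of_subspace S \<subseteq> GN" by (auto simp: face_of_subspace_def)
  show "convex (face_of_subspace S)"
    unfolding convex_def
  proof (intro ballI allI impI)
    fix A B :: "real^'n^'n" and u v :: real
    assume A: "A \<in> face_of_subspace S" and B: "B \<in> face_of_subspace S"
      and uv: "0 \<le> u" "0 \<le> v" "u + v = 1"
    have "u *\<^sub>R A + v *\<^sub>R B \<in> GN"
      using A B uv by (intro GN_combination) (auto simp: face_of_subspace_def)
    moreover have "A *v z \<in> S" "B *v z \<in> S" for z
      using A B by (auto simp: face_of_subspace_def)
    ultimately show "u *\<^sub>R A + v *\<^sub>R B \<in> face_of_subspace S"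
      by (auto simp: face_of_subspace_def mv_scaleR_combination S subspace_add subspace_scale)
  qed
  fix a b x
  assume ab: "a \<in> GN" "b \<in> GN" and x: "x \<in> face_of_subspace S" and "x \<in> open_segment a b"
  then obtain u where u: "0 < u" "u < 1" and xe: "x = (1 - u) *\<^sub>R a + u *\<^sub>R b"
    by (auto simp: in_segment)
  show "a \<in> face_of_subspace S"
    using face_of_subspace_convex_combination_left[OF S ab u] x xe by simp
  have "x = (1 - (1 - u)) *\<^sub>R b + (1 - u) *\<^sub>R a" using xe by simp
  then show "b \<in> face_of_subspace S"
    using face_of_subspace_convex_combination_left[OF S ab(2,1), of "1 - u"] x u by simp
qed

text \<open>Writing \<open>G = \<Sum>j. w\<^sub>j w\<^sub>j\<^sup>T\<close> with \<open>w\<^sub>j = G\<^sub>0 z\<^sub>j\<close>, Cauchy-Schwarz for \<open>G\<^sub>0\<close> bounds each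
  \<open>(w\<^sub>j \<bullet> x)\<^sup>2 = (z\<^sub>j \<bullet> G\<^sub>0 x)\<^sup>2\<close> by a multiple of \<open>x \<bullet> G\<^sub>0 x\<close>.\<close>
lemma psd_quadratic_form_le_if_range_subset:
  fixes G G0 :: "real^'n^'n"
  assumes p0: "psd G0" and p: "psd G" and r: "range ((*v) G) \<subseteq> range ((*v) G0)"
  obtains c where "c > 0" "\<And>x. x \<bullet> (G *v x) \<le> c * (x \<bullet> (G0 *v x))"
proof -
  obtain K :: nat and w where wR: "\<forall>j<K. w j \<in> range ((*v) G)" and Gw: "G = (\<Sum>j<K. outer (w j))"
    using psd_eq_sum_outer[OF p] by blast
  have "\<forall>j. \<exists>z. j < K \<longrightarrow> w j = G0 *v z" using wR r by blast
  then obtain z where wz: "\<And>j. j < K \<Longrightarrow> w j = G0 *v z j" by metis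
  define c where "c = 1 + (\<Sum>j<K. z j \<bullet> (G0 *v z j))"
  show ?thesis
  proof
    show "c > 0" unfolding c_def using psd_nonneg[OF p0] by (smt (verit) sum_nonneg)
    fix x
    define q where "q = x \<bullet> (G0 *v x)"
    have "x \<bullet> (G *v x) = (\<Sum>j<K. (w j \<bullet> x)\<^sup>2)"
      by (simp add: Gw sum_outer_mv inner_sum_right power2_eq_square inner_commute)
    also have "\<dots> \<le> (\<Sum>j<K. (z j \<bullet> (G0 *v z j)) * q)"
    proof (rule sum_mono)
      fix j assume "j \<in> {..<K}"
      then have "w j \<bullet> x = z j \<bullet> (G0 *v x)"
        using wz sym_mat_inner_mv[OF psd_sym[OF p0], of "z j" x] by simp
      then show "(w j \<bullet> x)\<^sup>2 \<le> (z j \<bullet> (G0 *v z j)) * q"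
        using psd_inner_mv_square_le[OF p0, of "z j" x] by (simp add: q_def)
    qed
    also have "\<dots> \<le> c * q"
      using psd_nonneg[OF p0, of x] by (simp add: c_def q_def sum_distrib_right distrib_right)
    finally show "x \<bullet> (G *v x) \<le> c * (x \<bullet> (G0 *v x))" by (simp add: q_def)
  qed
qed

text \<open>\<open>G\<^sub>0\<close> lies in the relative interior of \<open>F\<^sub>S\<close>, \<open>S = range G\<^sub>0\<close>: the segment from any
  \<open>G \<in> F\<^sub>S\<close> through \<open>G\<^sub>0\<close> extends to \<open>H = (1 + 1/c) G\<^sub>0 - (1/c) G \<in> GN\<close>.\<close>
lemma GN_open_segment_through:
  fixes G G0 :: "real^'n^'n"
  assumes G0: "G0 \<in> GN" and G: "G \<in> GN" and rG: "range ((*v) G) \<subseteq> range ((*v) G0)"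
    and ne: "G \<noteq> G0"
  obtains H where "H \<in> GN" "G0 \<in> open_segment G H"
proof -
  have p0: "psd G0" and p: "psd G" using G0 G by (auto simp: GN_def)
  obtain c where c: "c > 0" "\<And>x. x \<bullet> (G *v x) \<le> c * (x \<bullet> (G0 *v x))"
    using psd_quadratic_form_le_if_range_subset[OF p0 p rG] by blast
  define e where "e = 1 / c"
  have e: "e > 0" using c by (simp add: e_def)
  define H where "H = (1 + e) *\<^sub>R G0 - e *\<^sub>R G"
  have "H \<in> GN"
    unfolding GN_def psd_def
  proof (intro CollectI conjI allI)
    show "sym_mat H"
      using sym_mat_entry[OF psd_sym[OF p0]] sym_mat_entry[OF psd_sym[OF p]]
      by (simp add: sym_mat_def vec_eq_iff transpose_def H_def)
    fix x
    have "e * (x \<bullet> (G *v x)) \<le> e * (c * (x \<bullet> (G0 *v x)))"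
      using c(2) e by (intro mult_left_mono) auto
    then have "e * (x \<bullet> (G *v x)) \<le> x \<bullet> (G0 *v x)"
      using c by (simp add: e_def)
    moreover have "0 \<le> e * (x \<bullet> (G0 *v x))"
      using psd_nonneg[OF p0, of x] e by simp
    moreover have "x \<bullet> (H *v x) = (1 + e) * (x \<bullet> (G0 *v x)) - e * (x \<bullet> (G *v x))"
      by (simp add: H_def matrix_vector_mult_diff_rdistrib inner_diff_right
          flip: scaleR_matrix_vector_assoc)
    ultimately show "0 \<le> x \<bullet> (H *v x)"
      by (simp add: distrib_right)
  next
    fix i show "H $ i $ i = 1" using G0 G by (simp add: H_def GN_def)
  qed
  moreover have "G0 \<in> open_segment G H"
  proof -
    define u where "u = c / (c + 1)"
    have u: "0 < u" "u < 1" using c by (auto simp: u_def)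
    have "c + c * c \<noteq> 0" using c by (smt (verit) mult_pos_pos)
    then have eq: "G0 = (1 - u) *\<^sub>R G + u *\<^sub>R H"
      using c by (simp add: vec_eq_iff H_def u_def e_def field_simps)
    then have "G \<noteq> H" using ne by auto
    then show ?thesis unfolding in_segment using u eq by blast
  qed
  ultimately show ?thesis using that by blast
qed

lemma face_generated_GN:
  fixes G0 :: "real^'n^'n"
  assumes G0: "G0 \<in> GN"
  shows "face_generated GN G0 = face_of_subspace (range ((*v) G0))"
proof
  have G0F: "G0 \<in> face_of_subspace (range ((*v) G0))"
    using G0 by (auto simp: face_of_subspace_def)
  then show "face_generated GN G0 \<subseteq> face_of_subspace (range ((*v) G0))"
    unfolding face_generated_def using face_of_subspace_face_of_GN[OF subspace_range_mv] by blast
  show "face_of_subspace (range ((*v) G0)) \<subseteq> face_generated GN G0"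
    unfolding face_generated_def
  proof (intro subsetI InterI, clarify)
    fix G F assume GF: "G \<in> face_of_subspace (range ((*v) G0))" and F: "F face_of GN" "G0 \<in> F"
    then have G: "G \<in> GN" "range ((*v) G) \<subseteq> range ((*v) G0)"
      by (auto simp: face_of_subspace_def)
    show "G \<in> F"
    proof (cases "G = G0")
      case False
      then obtain H where "H \<in> GN" "G0 \<in> open_segment G H"
        using GN_open_segment_through[OF G0 G] by blast
      then show ?thesis using face_ofD[OF F(1) _ G(1)] F(2) by blast
    qed (use F in simp)
  qed
qed

text \<open>The columns \<open>v\<^sub>j\<close> of a factorisation \<open>G\<^sub>0 = \<Sum>j. v\<^sub>j v\<^sub>j\<^sup>T\<close> span \<open>range G\<^sub>0\<close>, and the unit
  diagonal of \<open>G\<^sub>0\<close> says that the rows of the matrix \<open>(v\<^sub>j)\<^sub>j\<close> are unit vectors.\<close>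
lemma completely_elliptic_range:
  fixes G0 :: "real^'n^'n"
  assumes G0: "G0 \<in> GN"
  shows "completely_elliptic (range ((*v) G0))"
proof -
  define S where "S = range ((*v) G0)"
  have subS: "subspace S" unfolding S_def by (rule subspace_range_mv)
  obtain K :: nat and v where K: "K \<le> dim S" and vS: "\<forall>j<K. v j \<in> S"
    and Gv: "G0 = (\<Sum>j<K. outer (v j))"
    using psd_eq_sum_outer[of G0] G0 unfolding S_def GN_def by blast
  define w where "w j = (if j < K then v j else 0)" for j
  have wS: "\<forall>j<dim S. w j \<in> S" using vS subspace_0[OF subS] by (simp add: w_def)
  have norm: "(\<Sum>j<dim S. (w j $ \<mu>)\<^sup>2) = 1" for \<mu>
  proof -
    have "(\<Sum>j<dim S. (w j $ \<mu>)\<^sup>2) = (\<Sum>j<K. (v j $ \<mu>)\<^sup>2)"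
      by (rule sum.mono_neutral_cong_right) (use K in \<open>auto simp: w_def\<close>)
    also have "\<dots> = G0 $ \<mu> $ \<mu>" by (simp add: Gv sum_component outer_def power2_eq_square)
    finally show ?thesis using G0 by (simp add: GN_def)
  qed
  have "S \<subseteq> span (w ` {..<dim S})"
  proof
    fix y assume "y \<in> S"
    then obtain z where "y = G0 *v z" unfolding S_def by auto
    then have "y = (\<Sum>j<K. (v j \<bullet> z) *\<^sub>R w j)"
      by (simp add: Gv sum_outer_mv w_def)
    also have "\<dots> \<in> span (w ` {..<dim S})"
      using K by (intro span_sum span_mul span_base) auto
    finally show "y \<in> span (w ` {..<dim S})" .
  qed
  moreover have "span (w ` {..<dim S}) \<subseteq> S"
    using wS subS by (intro span_minimal) auto
  ultimately have "span (w ` {..<dim S}) = S" by blast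
  then show ?thesis
    unfolding completely_elliptic_def S_def[symmetric]
    using subS wS norm by (intro conjI exI[of _ w]) (auto simp: dim_span)
qed

section \<open>Linear functionals on \<open>LN\<close>\<close>

lemma LN_add: "X \<in> LN \<Longrightarrow> Y \<in> LN \<Longrightarrow> X + Y \<in> LN"
  by (simp add: LN_def sym_mat_def zero_diag_def transpose_def vec_eq_iff)

lemma LN_scaleR: "X \<in> LN \<Longrightarrow> c *\<^sub>R X \<in> LN"
  by (simp add: LN_def sym_mat_def zero_diag_def transpose_def vec_eq_iff)

lemma LN_0: "0 \<in> LN"
  by (simp add: LN_def sym_mat_def zero_diag_def transpose_def vec_eq_iff)

lemma LN_sum: "(\<And>i. i \<in> I \<Longrightarrow> M i \<in> LN) \<Longrightarrow> (\<Sum>i\<in>I. M i) \<in> LN"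
  by (induction I rule: infinite_finite_induct) (simp_all add: LN_0 LN_add)

lemma GN_diff_in_LN:
  assumes "X \<in> GN" "Y \<in> GN"
  shows "X - Y \<in> LN"
proof -
  have "sym_mat X" "sym_mat Y" using assms by (auto simp: GN_def psd_def)
  then have "sym_mat (X - Y)" by (simp add: sym_mat_def transpose_def vec_eq_iff)
  moreover have "zero_diag (X - Y)" using assms by (simp add: GN_def zero_diag_def)
  ultimately show ?thesis by (simp add: LN_def)
qed

lemma lin_functionals_0:
  assumes "l \<in> lin_functionals"
  shows "l 0 = 0"
proof -
  have "l ((0::real) *\<^sub>R 0) = 0 * l 0"
    using assms LN_0 unfolding lin_functionals_def by blast
  then show ?thesis by simp
qed

lemma lin_functionals_sum:
  assumes l: "l \<in> lin_functionals"
  shows "(\<And>i. i \<in> I \<Longrightarrow> M i \<in> LN) \<Longrightarrow> l (\<Sum>i\<in>I. M i) = (\<Sum>i\<in>I. l (M i))"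
proof (induction I rule: infinite_finite_induct)
  case (insert x F)
  then have "M x \<in> LN" "(\<Sum>i\<in>F. M i) \<in> LN" by (auto intro: LN_sum)
  then show ?case using insert l by (simp add: lin_functionals_def)
qed (simp_all add: lin_functionals_0[OF l])

lemma lin_functionals_scaleR: "l \<in> lin_functionals \<Longrightarrow> X \<in> LN \<Longrightarrow> l (c *\<^sub>R X) = c * l X"
  unfolding lin_functionals_def by blast

text \<open>The standard basis of \<open>LN\<close>.\<close>
definition sym_unit :: "'n \<Rightarrow> 'n \<Rightarrow> real^'n^'n" where
  "sym_unit a b = (\<chi> p q. if p \<noteq> q \<and> ((p = a \<and> q = b) \<or> (p = b \<and> q = a)) then 1 else 0)"

lemma sym_unit_in_LN: "sym_unit a b \<in> LN"
  by (auto simp: LN_def sym_mat_def zero_diag_def transpose_def vec_eq_iff sym_unit_def)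

lemma sym_unit_commute: "sym_unit a b = sym_unit b a"
  by (auto simp: vec_eq_iff sym_unit_def)

lemma sym_unit_entry:
  "p \<noteq> q \<Longrightarrow> sym_unit a b $ p $ q = (if a = p \<and> b = q then 1 else 0) + (if a = q \<and> b = p then 1 else 0)"
  unfolding sym_unit_def by (cases "a = p"; cases "b = q"; cases "a = q"; cases "b = p") simp_all

lemma sym_unit_diag: "sym_unit a b $ p $ p = 0"
  by (simp add: sym_unit_def)

lemma trace_mult_sym_unit:
  assumes "a \<noteq> b"
  shows "trace ((A::real^'n^'n) ** sym_unit a b) = A $ b $ a + A $ a $ b"
proof -
  have "trace (A ** sym_unit a b) = (\<Sum>i\<in>UNIV. \<Sum>k\<in>UNIV.
      (if k = a then (if i = b then A $ i $ k else 0) else 0) +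
      (if k = b then (if i = a then A $ i $ k else 0) else 0))"
    unfolding trace_mult_eq_sum using assms
    by (intro sum.cong refl) (simp add: sym_unit_def)
  also have "\<dots> = A $ b $ a + A $ a $ b"
    by (simp add: sum.distrib)
  finally show ?thesis .
qed

lemma LN_eq_sum_sym_unit:
  assumes X: "X \<in> LN"
  shows "X = (\<Sum>a\<in>UNIV. \<Sum>b\<in>UNIV. (X $ a $ b / 2) *\<^sub>R sym_unit a b)"
proof -
  have Xs: "X $ a $ b = X $ b $ a" for a b using X sym_mat_entry unfolding LN_def by blast
  have Xd: "X $ a $ a = 0" for a using X by (auto simp: LN_def zero_diag_def)
  have entry: "X $ p $ q = (\<Sum>a\<in>UNIV. \<Sum>b\<in>UNIV. X $ a $ b / 2 * sym_unit a b $ p $ q)" for p q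
  proof (cases "p = q")
    case True then show ?thesis by (simp add: sym_unit_diag Xd)
  next
    case False
    have "(\<Sum>a\<in>UNIV. \<Sum>b\<in>UNIV. X $ a $ b / 2 * sym_unit a b $ p $ q) =
          (\<Sum>a\<in>UNIV. \<Sum>b\<in>UNIV. (if b = q then (if a = p then X $ a $ b / 2 else 0) else 0)
                + (if b = p then (if a = q then X $ a $ b / 2 else 0) else 0))"
      using False by (intro sum.cong refl) (simp add: sym_unit_entry distrib_left)
    also have "\<dots> = X $ p $ q" using Xs[of p q] by (simp add: sum.distrib)
    finally show ?thesis by simp
  qed
  show ?thesis
    by (simp only: vec_eq_iff sum_component vector_scaleR_component real_scaleR_def)
      (intro allI entry)
qed

lemma lin_functionals_eq_trace:
  assumes l: "l \<in> lin_functionals" and X: "X \<in> LN"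
  shows "l X = trace ((\<chi> a b. l (sym_unit a b) / 2) ** X)"
proof -
  have Xs: "X $ a $ b = X $ b $ a" for a b using X sym_mat_entry unfolding LN_def by blast
  have inLN: "(\<Sum>b\<in>UNIV. (X $ a $ b / 2) *\<^sub>R sym_unit a b) \<in> LN" for a
    by (intro LN_sum) (auto intro: LN_scaleR sym_unit_in_LN)
  have "l X = l (\<Sum>a\<in>UNIV. \<Sum>b\<in>UNIV. (X $ a $ b / 2) *\<^sub>R sym_unit a b)"
    by (rule arg_cong[where f = l, OF LN_eq_sum_sym_unit[OF X]])
  also have "\<dots> = (\<Sum>a\<in>UNIV. l (\<Sum>b\<in>UNIV. (X $ a $ b / 2) *\<^sub>R sym_unit a b))"
    using inLN by (intro lin_functionals_sum[OF l]) auto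
  also have "\<dots> = (\<Sum>a\<in>UNIV. \<Sum>b\<in>UNIV. l ((X $ a $ b / 2) *\<^sub>R sym_unit a b))"
    by (intro sum.cong refl lin_functionals_sum[OF l]) (auto intro: LN_scaleR sym_unit_in_LN)
  also have "\<dots> = (\<Sum>a\<in>UNIV. \<Sum>b\<in>UNIV. X $ a $ b / 2 * l (sym_unit a b))"
    by (intro sum.cong refl lin_functionals_scaleR[OF l] sym_unit_in_LN)
  also have "\<dots> = trace ((\<chi> a b. l (sym_unit a b) / 2) ** X)"
    unfolding trace_mult_eq_sum
  proof (intro sum.cong refl)
    fix a b
    show "X $ a $ b / 2 * l (sym_unit a b) = (\<chi> a b. l (sym_unit a b) / 2) $ a $ b * X $ b $ a"
      using Xs[of b a] by simp
  qed
  finally show ?thesis .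
qed

lemma inj_on_tr_functional:
  fixes G0 :: "real^'n^'n"
  assumes "G0 \<in> GN"
  shows "inj_on tr_functional {A. psd A \<and> A ** G0 = 0}"
proof (rule inj_onI, clarify)
  fix A B :: "real^'n^'n"
  assume A: "psd A" "A ** G0 = 0" and B: "psd B" "B ** G0 = 0"
    and eq: "tr_functional A = tr_functional B"
  have off: "A $ a $ b = B $ a $ b" if "a \<noteq> b" for a b
    using fun_cong[OF eq, of "sym_unit a b"] that
      sym_mat_entry[OF psd_sym[OF A(1)], of a b] sym_mat_entry[OF psd_sym[OF B(1)], of a b]
    by (simp add: tr_functional_def sym_unit_in_LN trace_mult_sym_unit)
  \<comment> \<open>the diagonal is recovered from \<open>(A G\<^sub>0)\<^sub>a\<^sub>a = 0\<close> and \<open>(G\<^sub>0)\<^sub>a\<^sub>a = 1\<close>\<close>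
  have "A $ a $ a = B $ a $ a" for a
  proof -
    have "(\<Sum>k\<in>UNIV. (A $ a $ k - B $ a $ k) * G0 $ k $ a) = 0"
      using A(2) B(2) by (simp add: vec_eq_iff matrix_matrix_mult_def left_diff_distrib sum_subtractf)
    also have "(\<Sum>k\<in>UNIV. (A $ a $ k - B $ a $ k) * G0 $ k $ a) = A $ a $ a - B $ a $ a"
      using assms by (subst sum.remove[of _ a]) (auto simp: off GN_def)
    finally show ?thesis by simp
  qed
  with off show "A = B" by (metis vec_eq_iff)
qed

lemma tr_functional_in_cone_C:
  fixes A G0 :: "real^'n^'n"
  assumes G0: "G0 \<in> GN" and A: "psd A" "A ** G0 = 0"
  shows "tr_functional A \<in> cone_C G0"
proof -
  have tr0: "trace (A ** G0) = 0" using A(2) by (simp add: trace_def)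
  have "tr_functional A \<in> lin_functionals"
    unfolding lin_functionals_def tr_functional_def
    by (auto simp: LN_add LN_scaleR trace_mult_add_right trace_mult_scaleR_right)
  moreover have "0 \<le> tr_functional A (G - G0)" if "G \<in> GN" for G
    using tr0 GN_diff_in_LN[OF that G0] that trace_mult_psd_nonneg[OF A(1), of G]
    by (simp add: tr_functional_def trace_mult_diff_right GN_def)
  ultimately show ?thesis by (simp add: cone_C_def)
qed

section \<open>Lagrange multipliers and the cone \<open>C(G\<^sub>0)\<close>\<close>

lemma nonneg_if_nonneg_on_positive_reals:
  fixes a b :: real
  assumes "\<And>s. 0 < s \<Longrightarrow> 0 \<le> a + b * s"
  shows "0 \<le> a" "0 \<le> b"
proof -
  show "0 \<le> b"
  proof (rule ccontr)
    assume "\<not> 0 \<le> b"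
    then have "0 \<le> a + b * ((\<bar>a\<bar> + 1) / - b)" by (intro assms divide_pos_pos) auto
    then show False using \<open>\<not> 0 \<le> b\<close> by simp
  qed
  show "0 \<le> a"
  proof (rule ccontr)
    assume "\<not> 0 \<le> a"
    have "0 \<le> a + b * (- a / (2 * (b + 1)))"
      using \<open>\<not> 0 \<le> a\<close> \<open>0 \<le> b\<close> by (intro assms divide_pos_pos) auto
    also have "\<dots> \<le> a / 2" using \<open>\<not> 0 \<le> a\<close> \<open>0 \<le> b\<close> by (simp add: field_simps)
    finally show False using \<open>\<not> 0 \<le> a\<close> by simp
  qed
qed

text \<open>Lagrange duality for minimising \<open>G \<mapsto> tr (J G)\<close> over \<open>GN\<close>: separating \<open>0\<close> from the
  convex set of values \<open>(diag G - 1, tr (J G) - tr (J G\<^sub>0) + s)\<close>, \<open>G \<succeq> 0\<close>, \<open>s > 0\<close>, by a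
  functional \<open>(\<lambda>, \<mu>)\<close> gives \<open>\<mu> > 0\<close> (Slater: diagonal matrices are interior), and
  \<open>\<kappa> = \<lambda> / \<mu>\<close> turns \<open>G\<^sub>0\<close> into a minimiser of \<open>tr (J(\<kappa>) G)\<close> over all \<open>G \<succeq> 0\<close>.\<close>
lemma lagrange_multipliers_GN:
  fixes J G0 :: "real^'n^'n"
  assumes G0: "G0 \<in> GN" and min: "\<And>G. G \<in> GN \<Longrightarrow> trace (J ** G0) \<le> trace (J ** G)"
  obtains k where "\<And>G. psd G \<Longrightarrow> trace (Jk J k ** G0) \<le> trace (Jk J k ** G)"
proof -
  define t0 where "t0 = trace (J ** G0)"
  define f :: "(real^'n^'n) \<times> real \<Rightarrow> (real^'n) \<times> real"
    where "f p = ((\<chi> i. fst p $ i $ i), trace (J ** fst p) + snd p)" for p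
  define D where "D = (\<lambda>y. y - ((\<chi> i. 1), t0)) ` f ` ({G. psd G} \<times> {0<..})"
  have "linear f"
    by (rule linearI)
      (simp_all add: f_def vec_eq_iff trace_mult_add_right trace_mult_scaleR_right algebra_simps)
  moreover have "convex ({G. psd G} \<times> {0::real<..})"
    using convex_psd by (rule convex_Times) simp
  ultimately have "convex D"
    unfolding D_def by (intro convex_translation_subtract convex_linear_image)
  moreover have "0 \<notin> D"
  proof
    assume "0 \<in> D"
    then obtain G s where "psd G" "0 < s" "f (G, s) = ((\<chi> i. 1), t0)"
      unfolding D_def by auto
    then have "G \<in> GN" "trace (J ** G) < t0"
      by (auto simp: f_def GN_def vec_eq_iff)
    then show False using min t0_def by force
  qed
  ultimately obtain a where a0: "a \<noteq> 0" and sep: "\<And>x. x \<in> D \<Longrightarrow> 0 \<le> a \<bullet> x"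
    using separating_hyperplane_set_0 by blast
  obtain lam mu where a: "a = (lam, mu)" by (cases a)
  define L where "L G = lam \<bullet> ((\<chi> i. G $ i $ i) - (\<chi> i. 1)) + mu * (trace (J ** G) - t0)" for G
  have "0 \<le> L G + mu * s" if "psd G" "0 < s" for G s
  proof -
    have "f (G, s) - ((\<chi> i. 1), t0) \<in> D" using that unfolding D_def by blast
    from sep[OF this] show ?thesis by (simp add: a L_def f_def inner_diff_right algebra_simps)
  qed
  then have L: "\<And>G. psd G \<Longrightarrow> 0 \<le> L G" and "0 \<le> mu"
    using nonneg_if_nonneg_on_positive_reals psd_0 by blast+
  moreover have "mu \<noteq> 0"
  proof
    assume mu: "mu = 0"
    \<comment> \<open>then \<open>\<lambda> \<bullet> (diag G - 1) \<ge> 0\<close> for all \<open>G \<succeq> 0\<close>; test it on \<open>G = diag (1 \<plusminus> e\<^sub>i)\<close>\<close>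
    have "t * lam $ i \<ge> 0" if "t \<in> {-1, 1}" for t i
    proof -
      define d :: "real^'n" where "d = (\<chi> j. 1) + t *\<^sub>R axis i 1"
      have "psd (diagm d)" using that by (intro psd_diagm) (auto simp: d_def axis_def)
      moreover have "(\<chi> j. diagm d $ j $ j) = d" by (simp add: diagm_def vec_eq_iff)
      ultimately show ?thesis using L[of "diagm d"] mu by (simp add: L_def d_def inner_axis)
    qed
    from this[of 1] this[of "-1"] have "lam = 0" by (simp add: vec_eq_iff order_antisym)
    then show False using a0 a mu by (simp add: zero_prod_def)
  qed
  ultimately have mu: "0 < mu" by simp
  show ?thesis
  proof (rule that[of "(1 / mu) *\<^sub>R lam"])
    fix G :: "real^'n^'n" assume "psd G"
    have "trace (Jk J ((1 / mu) *\<^sub>R lam) ** G) - trace (Jk J ((1 / mu) *\<^sub>R lam) ** G0) = L G / mu"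
      using G0 mu by (simp add: trace_Jk_mult L_def t0_def GN_def inner_diff_right field_simps)
    also have "\<dots> \<ge> 0" using L[OF \<open>psd G\<close>] mu by simp
    finally show "trace (Jk J ((1 / mu) *\<^sub>R lam) ** G0) \<le> trace (Jk J ((1 / mu) *\<^sub>R lam) ** G)"
      by simp
  qed
qed

lemma psd_if_trace_minimiser:
  fixes A G0 :: "real^'n^'n"
  assumes Asym: "sym_mat A" and p0: "psd G0"
    and min: "\<And>G. psd G \<Longrightarrow> trace (A ** G0) \<le> trace (A ** G)"
  shows "psd A" "A ** G0 = 0"
proof -
  have c0: "trace (A ** G0) \<le> 0" using min[OF psd_0] by (simp add: trace_def)
  show psdA: "psd A"
    unfolding psd_def
  proof (intro conjI allI Asym)
    fix x
    show "0 \<le> x \<bullet> (A *v x)"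
    proof (rule ccontr)
      assume n: "\<not> 0 \<le> x \<bullet> (A *v x)"
      \<comment> \<open>a large multiple of \<open>x x\<^sup>T\<close> would push \<open>tr (A G)\<close> below \<open>tr (A G\<^sub>0) - 1\<close>\<close>
      define r where "r = (1 - trace (A ** G0)) / (- (x \<bullet> (A *v x)))"
      have rp: "0 \<le> r" unfolding r_def using n c0 by (intro divide_nonneg_nonneg) auto
      have "trace (A ** G0) \<le> trace (A ** (r *\<^sub>R outer x))"
        by (rule min[OF psd_scaleR[OF psd_outer rp]])
      also have "\<dots> = r * (x \<bullet> (A *v x))"
        by (simp add: trace_mult_scaleR_right trace_mult_outer)
      also have "\<dots> = trace (A ** G0) - 1"
        using n by (simp add: r_def)
      finally show False by simp
    qed
  qed
  have "trace (A ** G0) = 0" using c0 trace_mult_psd_nonneg[OF psdA p0] by simp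
  then show "A ** G0 = 0" by (rule trace_mult_psd_eq_0D[OF psdA p0])
qed

lemma cone_C_subset_tr_functional_image:
  fixes G0 :: "real^'n^'n"
  assumes G0: "G0 \<in> GN" and l: "l \<in> cone_C G0"
  obtains A where "psd A" "A ** G0 = 0" "tr_functional A = l"
proof -
  have lf: "l \<in> lin_functionals" and lpos: "\<And>G. G \<in> GN \<Longrightarrow> 0 \<le> l (G - G0)"
    using l by (auto simp: cone_C_def)
  define J :: "real^'n^'n" where "J = (\<chi> a b. l (sym_unit a b) / 2)"
  have lJ: "l X = trace (J ** X)" if "X \<in> LN" for X
    unfolding J_def by (rule lin_functionals_eq_trace[OF lf that])
  have "trace (J ** G0) \<le> trace (J ** G)" if "G \<in> GN" for G
    using lpos[OF that] lJ[OF GN_diff_in_LN[OF that G0]] by (simp add: trace_mult_diff_right)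
  then obtain k where k: "\<And>G. psd G \<Longrightarrow> trace (Jk J k ** G0) \<le> trace (Jk J k ** G)"
    using lagrange_multipliers_GN[OF G0] by blast
  have "sym_mat (Jk J k)"
    by (simp add: sym_mat_def vec_eq_iff transpose_def Jk_def diagm_def J_def sym_unit_commute)
  note A = psd_if_trace_minimiser[OF this _ k] G0[unfolded GN_def]
  \<comment> \<open>\<open>tr_functional\<close> only sees the off-diagonal part, where \<open>J(\<kappa>)\<close> agrees with \<open>J\<close>\<close>
  have "tr_functional (Jk J k) = l"
  proof
    fix X
    show "tr_functional (Jk J k) X = l X"
      using lJ lf by (cases "X \<in> LN")
        (auto simp: tr_functional_def trace_Jk_mult LN_def zero_diag_def lin_functionals_def
          simp flip: zero_vec_def)
  qed
  with A show ?thesis using that by auto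
qed

lemma range_orthogonal_range_iff_mult_eq_0:
  fixes A G0 :: "real^'n^'n"
  assumes "sym_mat A"
  shows "range ((*v) A) \<subseteq> orthogonal_comp (range ((*v) G0)) \<longleftrightarrow> A ** G0 = 0"
proof
  show "range ((*v) A) \<subseteq> orthogonal_comp (range ((*v) G0)) \<Longrightarrow> A ** G0 = 0"
    using sym_mat_mult_eq_0_if_range_orthogonal[OF assms] by blast
  assume "A ** G0 = 0"
  then have "(G0 *v v) \<bullet> (A *v w) = 0" for v w
    using sym_mat_inner_mv[OF assms, of "G0 *v v" w] by (simp add: matrix_vector_mul_assoc)
  then show "range ((*v) A) \<subseteq> orthogonal_comp (range ((*v) G0))"
    by (auto simp: orthogonal_comp_def orthogonal_def)
qed

lemma bij_betw_tr_functional_cone_C: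
  fixes G0 :: "real^'n^'n"
  assumes G0: "G0 \<in> GN"
  shows "bij_betw tr_functional {A. psd A \<and> range ((*v) A) \<subseteq> orthogonal_comp (range ((*v) G0))}
    (cone_C G0)"
proof -
  have "{A. psd A \<and> range ((*v) A) \<subseteq> orthogonal_comp (range ((*v) G0))} = {A. psd A \<and> A ** G0 = 0}"
    using range_orthogonal_range_iff_mult_eq_0 psd_sym by blast
  moreover have "tr_functional ` {A. psd A \<and> A ** G0 = 0} = cone_C G0"
    using tr_functional_in_cone_C[OF G0] cone_C_subset_tr_functional_image[OF G0]
    by (auto simp: image_iff) metis
  ultimately show ?thesis
    using inj_on_tr_functional[OF G0] by (simp add: bij_betw_def)
qed

lemma tr_functional_convex_combination:
  "tr_functional ((1 - t) *\<^sub>R A + t *\<^sub>R B) = (\<lambda>X. (1 - t) * tr_functional A X + t * tr_functional B X)"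
  by (rule ext) (simp add: tr_functional_def trace_mult_scaleR_combination_left)

lemma ground_state_of_psd_orthogonal:
  fixes A :: "real^'n^'n"
  assumes "psd A" "range ((*v) A) \<subseteq> orthogonal_comp S"
  shows "let J' = (\<chi> i j. if i = j then 0 else A $ i $ j); k = (\<chi> i. A $ i $ i) in
    A = Jk J' k \<and> sym_mat J' \<and> zero_diag J' \<and>
    (\<forall>s :: real^'m^'n. spin_config s \<and> Gram s \<in> face_of_subspace S \<longrightarrow>
      ground_state J' s \<and> Jk J' k ** s = 0)"
  unfolding Let_def
proof (intro conjI allI impI)
  show "A = Jk (\<chi> i j. if i = j then 0 else A $ i $ j) (\<chi> i. A $ i $ i)"
    by (rule Jk_off_diagonal_diagonal)
  show "sym_mat (\<chi> i j. if i = j then 0 else A $ i $ j)"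
    by (rule sym_mat_off_diagonal[OF psd_sym[OF assms(1)]])
  show "zero_diag (\<chi> i j. if i = j then 0 else A $ i $ j)"
    by (simp add: zero_diag_def)
qed (use ground_state_if_range_orthogonal[OF assms] in blast)+

lemma face_generated_and_cone_C:
  fixes G0 :: "real^'n^'n"
  assumes "G0 \<in> GN"
  shows "\<exists>S. completely_elliptic S \<and> face_generated GN G0 = face_of_subspace S \<and>
    (let P = {A. psd A \<and> range ((*v) A) \<subseteq> orthogonal_comp S} in
      bij_betw tr_functional P (cone_C G0) \<and>
      (\<forall>A\<in>P. \<forall>B\<in>P. \<forall>t::real. 0 \<le> t \<and> t \<le> 1 \<longrightarrow>
        tr_functional ((1 - t) *\<^sub>R A + t *\<^sub>R B) =
        (\<lambda>X. (1 - t) * tr_functional A X + t * tr_functional B X)))"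
  unfolding Let_def
  by (intro exI[of _ "range ((*v) G0)"] conjI ballI allI impI completely_elliptic_range[OF assms]
      face_generated_GN[OF assms] bij_betw_tr_functional_cone_C[OF assms]
      tr_functional_convex_combination)

theorem theorem3:
  fixes J :: "real^'n^'n"
  assumes J_sym: "sym_mat J" and J_diag: "zero_diag J"
  shows
   "(\<forall>(s :: real^'m^'n) k. ground_state J s \<and> Jk J k ** s = 0 \<longrightarrow> Jk J k ** Gram s = 0)
    \<and>
    (\<forall>S A. completely_elliptic S \<and> closed (face_of_subspace S) \<and>
        face_of_subspace S face_of GN \<and>
        face_of_subspace S \<noteq> {} \<and> face_of_subspace S \<noteq> GN \<and>
        psd A \<and> range ((*v) A) = orthogonal_comp S \<longrightarrow>
        (let J' = (\<chi> i j. if i = j then 0 else A $ i $ j); k = (\<chi> i. A $ i $ i) in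
          A = Jk J' k \<and> sym_mat J' \<and> zero_diag J' \<and>
          (\<forall>s :: real^'m^'n. spin_config s \<and> Gram s \<in> face_of_subspace S \<longrightarrow>
              ground_state J' s \<and> Jk J' k ** s = 0)))
    \<and>
    (\<forall>G0 :: real^'n^'n. G0 \<in> GN \<and> rank G0 < CARD('n) \<longrightarrow>
       (\<exists>S. completely_elliptic S \<and>
            face_generated GN G0 = face_of_subspace S \<and>
            (let P = {A. psd A \<and> range ((*v) A) \<subseteq> orthogonal_comp S} in
              bij_betw tr_functional P (cone_C G0) \<and>
              (\<forall>A\<in>P. \<forall>B\<in>P. \<forall>t::real. 0 \<le> t \<and> t \<le> 1 \<longrightarrow>
                 tr_functional ((1 - t) *\<^sub>R A + t *\<^sub>R B) =
                 (\<lambda>X. (1 - t) * tr_functional A X + t * tr_functional B X)))))"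
proof (intro conjI allI impI)
  fix s :: "real^'m^'n" and k :: "real^'n"
  assume "ground_state J s \<and> Jk J k ** s = 0"
  then show "Jk J k ** Gram s = 0" by (simp add: Gram_def matrix_mul_assoc)
next
  \<comment> \<open>of the hypotheses in (ii) only \<open>A \<succeq> 0\<close> and \<open>range A \<subseteq> S\<^sup>\<perp>\<close> are needed, and (iii)
    does not need \<open>rank G\<^sub>0 < N\<close>\<close>
  fix S :: "(real^'n) set" and A :: "real^'n^'n"
  assume "completely_elliptic S \<and> closed (face_of_subspace S) \<and>
    face_of_subspace S face_of GN \<and> face_of_subspace S \<noteq> {} \<and> face_of_subspace S \<noteq> GN \<and>
    psd A \<and> range ((*v) A) = orthogonal_comp S"
  then show "let J' = (\<chi> i j. if i = j then 0 else A $ i $ j); k = (\<chi> i. A $ i $ i) in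
      A = Jk J' k \<and> sym_mat J' \<and> zero_diag J' \<and>
      (\<forall>s :: real^'m^'n. spin_config s \<and> Gram s \<in> face_of_subspace S \<longrightarrow>
          ground_state J' s \<and> Jk J' k ** s = 0)"
    by (intro ground_state_of_psd_orthogonal) auto
qed (use face_generated_and_cone_C in blast)

end
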